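(* Let $K>0$ and let $F:\Omega\to\mathbb{R}$ be a random variable such that $$\left\|\sum_{k=0}^\infty\frac{1}{2(p_k\wedge q_k)}\,|D_kF|\,\|D_kF\|_\infty\right\|_\infty\le K^2.$$ Then $$\mathbb{P}(F-E[F]\ge x)\le\exp\left(-\frac{x^2}{2K^2}\right),\qquad x\ge0.$$
   Context: $\mathbb{N}=\{0,1,2,\ldots\}$. Let $(p_k)_{k\in\mathbb{N}}$ be a deterministic sequence in $(0,1)$ and $q_k=1-p_k$. Let $\Omega=\{-1,1\}^{\mathbb{N}}$ with its product $\sigma$-algebra, let $X_k:\Omega\to\{-1,1\}$ be the canonical projections, and let $\mathbb{P}$ be the product probability measure under which the $X_k$ are independent with $\mathbb{P}(X_k=1)=p_k$, $\mathbb{P}(X_k=-1)=q_k$. For $F:\Omega\to\mathbb{R}$, $D_kF(\omega)=\sqrt{p_kq_k}\,(F(\omega_+^k)-F(\omega_-^k))$, where $\omega_\pm^k$ is $\omega$ with its $k$-th coordinate replaced by $\pm1$. $\|\cdot\|_\infty$ is the norm of $L^\infty(\Omega,\mathbb{P})$ and $p_k\wedge q_k=\min(p_k,q_k)$. *)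

theory Defs
  imports "HOL-Probability.Probability"
begin

definition sign_measure :: "real \<Rightarrow> int measure" where
  "sign_measure r = point_measure {-1, 1} (\<lambda>s. ennreal (if s = 1 then r else 1 - r))"

definition bernoulli_space :: "(nat \<Rightarrow> real) \<Rightarrow> (nat \<Rightarrow> int) measure" where
  "bernoulli_space p = PiM UNIV (\<lambda>k. sign_measure (p k))"

definition discrete_gradient ::
    "(nat \<Rightarrow> real) \<Rightarrow> nat \<Rightarrow> ((nat \<Rightarrow> int) \<Rightarrow> real) \<Rightarrow> (nat \<Rightarrow> int) \<Rightarrow> real" where
  "discrete_gradient p k F \<omega> = sqrt (p k * (1 - p k)) * (F (fun_upd \<omega> k 1) - F (fun_upd \<omega> k (-1)))"

text \<open>The \<open>L\<^sup>\<infinity>\<close> norm is taken of the pointwise modulus of a function, with values in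
  \<open>[0, \<infinity>]\<close>: it also makes sense for series of nonnegative terms that may diverge, and
  is \<open>\<infinity>\<close> for functions that are not essentially bounded.\<close>

definition Linf_norm :: "'a measure \<Rightarrow> ('a \<Rightarrow> ennreal) \<Rightarrow> ennreal" where
  "Linf_norm M f = esssup M f"

lemma space_bernoulli_space: "space (bernoulli_space p) = UNIV \<rightarrow> {-1, 1}"
  by (simp add: bernoulli_space_def space_PiM sign_measure_def space_point_measure PiE_UNIV_domain)

lemma prob_space_sign_measure:
  assumes "0 < r" "r < 1"
  shows "prob_space (sign_measure r)"
  using assms
  by (intro prob_spaceI)
     (simp add: sign_measure_def space_point_measure emeasure_point_measure_finite
        flip: ennreal_plus)

lemma prob_space_bernoulli_space:
  assumes "\<And>k. 0 < p k \<and> p k < 1"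
  shows "prob_space (bernoulli_space p)"
  unfolding bernoulli_space_def using assms by (intro prob_space_PiM prob_space_sign_measure) auto

end

theory Submission
  imports Defs
begin

text \<open>
  Averaging out the coordinates one after the other, \<open>F = B\<^sub>0, B\<^sub>1, B\<^sub>2, \<dots>\<close>, gives a reverse
  martingale that tends to \<open>E[F]\<close> in \<open>L\<^sup>1\<close>. Its increments satisfy
  \<open>E[(B\<^sub>k - B\<^sub>k\<^sub>+\<^sub>1) G] = E[D\<^sub>k B\<^sub>k \<cdot> D\<^sub>k G]\<close>, and \<open>D\<^sub>k B\<^sub>k\<close> is an average of \<open>D\<^sub>k F\<close>, so
  \<open>Cov(F, G) \<le> \<Sum>\<^sub>k \<parallel>D\<^sub>k F\<parallel>\<^sub>\<infinity> E\<bar>D\<^sub>k G\<bar>\<close>. For bounded \<open>F\<close> and \<open>G = e\<^sup>s\<^sup>F\<close>, the trapezoidal bound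
  \<open>\<bar>e\<^sup>a - e\<^sup>b\<bar> \<le> \<bar>a - b\<bar> (e\<^sup>a + e\<^sup>b) / 2\<close>, together with
  \<open>min p\<^sub>k q\<^sub>k (e\<^sup>a + e\<^sup>b) \<le> p\<^sub>k e\<^sup>a + q\<^sub>k e\<^sup>b\<close>, turns this into \<open>Cov(F, e\<^sup>s\<^sup>F) \<le> s K\<^sup>2 E[e\<^sup>s\<^sup>F]\<close>, a differential
  inequality for the Laplace transform whose solution is the Gaussian bound
  \<open>exp (s\<^sup>2 K\<^sup>2 / 2)\<close>.

  Clamping \<open>F\<close> to \<open>[-n, n]\<close> only decreases its gradients, so the clamped functions are uniformly
  sub-Gaussian around their means; since \<open>F\<close> is finite these means are bounded, which forces
  \<open>F\<close> to be integrable and allows passing to the limit in the Chernoff bound.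
\<close>

subsection \<open>Averaging over coordinates\<close>

locale biased_signs =
  fixes p :: "nat \<Rightarrow> real"
  assumes p_pos: "0 < p k" and p_less_1: "p k < 1"
begin

abbreviation "M \<equiv> bernoulli_space p"

sublocale prob_space M
  using p_pos p_less_1 by (intro prob_space_bernoulli_space) auto

lemma measurable_update [measurable]:
  assumes "s \<in> {-1, 1}"
  shows "(\<lambda>\<xi>. \<xi>(k := s)) \<in> measurable M M"
  unfolding bernoulli_space_def
  by (rule measurable_fun_upd[where J = UNIV])
     (use assms in \<open>auto simp: sign_measure_def space_point_measure\<close>)

lemma update_in_space: "\<xi> \<in> space M \<Longrightarrow> s \<in> {-1, 1} \<Longrightarrow> \<xi>(k := s) \<in> space M"
  by (auto simp: space_bernoulli_space Pi_iff)

text \<open>Resampling one coordinate independently preserves a product measure. Every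
  measure-theoretic fact about \<open>average\<close> below rests on this invariance.\<close>

lemma distr_update:
  "distr (sign_measure (p k) \<Otimes>\<^sub>M M) M (\<lambda>(s, \<xi>). \<xi>(k := s)) = M"
  using distr_pair_PiM_eq_PiM[of UNIV "\<lambda>k. sign_measure (p k)" k]
    prob_space_sign_measure p_pos p_less_1
  by (simp add: bernoulli_space_def)

lemma measurable_update_pair [measurable]:
  "(\<lambda>(s, \<xi>). \<xi>(k := s)) \<in> measurable (sign_measure (p k) \<Otimes>\<^sub>M M) M"
  unfolding bernoulli_space_def case_prod_beta
  by (rule measurable_fun_upd[where J = UNIV]) auto

lemma AE_sign_measure_iff: "(AE s in sign_measure (p k). Q s) \<longleftrightarrow> (\<forall>s\<in>{-1, 1}. Q s)"
  unfolding sign_measure_def AE_point_measure using p_pos[of k] p_less_1[of k] by auto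

text \<open>This is the conditional expectation given all coordinates other than \<open>k\<close>,
  written as an explicit two-point sum. It is thus defined at every point, and algebraic identities
  hold without exceptional null sets.\<close>

definition average :: "nat \<Rightarrow> ((nat \<Rightarrow> int) \<Rightarrow> real) \<Rightarrow> (nat \<Rightarrow> int) \<Rightarrow> real" where
  "average k f \<xi> = p k * f (\<xi>(k := 1)) + (1 - p k) * f (\<xi>(k := -1))"

text \<open>Both values have positive probability, so a null set stays null when a coordinate is frozen.\<close>

lemma AE_update:
  assumes "AE \<xi> in M. Q \<xi>" "s \<in> {-1, 1}"
  shows "AE \<xi> in M. Q (\<xi>(k := s))"
proof -
  interpret S: prob_space "sign_measure (p k)"
    using p_pos p_less_1 by (rule prob_space_sign_measure)
  interpret pair_prob_space "sign_measure (p k)" M ..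
  have "AE x in distr (sign_measure (p k) \<Otimes>\<^sub>M M) M (\<lambda>(s, \<xi>). \<xi>(k := s)). Q x"
    using assms(1) by (subst distr_update)
  then have "AE x in sign_measure (p k) \<Otimes>\<^sub>M M. Q ((\<lambda>(s, \<xi>). \<xi>(k := s)) x)"
    by (rule AE_distrD[rotated]) measurable
  from AE_pair[OF this] show ?thesis
    using assms(2) unfolding AE_sign_measure_iff by auto
qed

text \<open>Fubini for the resampling map of \<open>distr_update\<close>. Almost every section in
  the sign variable is integrable, and both signs are atoms of positive mass, so both sections are;
  summing over the two atoms gives the mean.\<close>

lemma
  assumes "integrable M f"
  shows integrable_update: "s \<in> {-1, 1} \<Longrightarrow> integrable M (\<lambda>\<xi>. f (\<xi>(k := s)))"
    and integrable_average: "integrable M (average k f)"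
    and integral_average: "(\<integral>\<xi>. average k f \<xi> \<partial>M) = (\<integral>\<xi>. f \<xi> \<partial>M)"
proof -
  interpret S: prob_space "sign_measure (p k)"
    using p_pos p_less_1 by (rule prob_space_sign_measure)
  interpret pair_prob_space "sign_measure (p k)" M ..
  let ?T = "\<lambda>(s, \<xi>). (\<xi> :: nat \<Rightarrow> int)(k := s)"
  have int: "integrable (sign_measure (p k) \<Otimes>\<^sub>M M) (\<lambda>x. f (?T x))"
    by (rule integrable_distr[OF measurable_update_pair]) (simp add: distr_update assms)
  have *: "integrable M (\<lambda>\<xi>. f (\<xi>(k := s)))" if "s \<in> {-1, 1}" for s
    using AE_integrable_fst'[OF int] that unfolding AE_sign_measure_iff by auto
  then show "s \<in> {-1, 1} \<Longrightarrow> integrable M (\<lambda>\<xi>. f (\<xi>(k := s)))" .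
  show "integrable M (average k f)"
    unfolding average_def using *[of 1] *[of "-1"] by auto
  have "(\<integral>\<xi>. f \<xi> \<partial>M) = (\<integral>x. f (?T x) \<partial>(sign_measure (p k) \<Otimes>\<^sub>M M))"
    using integral_distr[OF measurable_update_pair, of f k] assms by (simp add: distr_update)
  also have "\<dots> = (\<integral>s. (\<integral>\<xi>. f (\<xi>(k := s)) \<partial>M) \<partial>sign_measure (p k))"
    using integral_fst'[OF int] by simp
  also have "\<dots> = (\<integral>\<xi>. average k f \<xi> \<partial>M)"
    unfolding sign_measure_def average_def
    using *[of 1] *[of "-1"] p_pos[of k] p_less_1[of k]
    by (subst lebesgue_integral_point_measure_finite) auto
  finally show "(\<integral>\<xi>. average k f \<xi> \<partial>M) = (\<integral>\<xi>. f \<xi> \<partial>M)" ..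
qed

text \<open>\<open>AE_update\<close> carries the bound to both frozen values, and a convex
  combination preserves it. Essential bounds on gradients survive averaging in this way.\<close>

lemma AE_abs_average_le:
  assumes "AE \<xi> in M. \<bar>f \<xi>\<bar> \<le> c"
  shows "AE \<xi> in M. \<bar>average k f \<xi>\<bar> \<le> c"
proof -
  have "AE \<xi> in M. \<bar>f (\<xi>(k := 1))\<bar> \<le> c" "AE \<xi> in M. \<bar>f (\<xi>(k := -1))\<bar> \<le> c"
    by (auto intro!: AE_update[where Q = "\<lambda>\<xi>. \<bar>f \<xi>\<bar> \<le> c"] assms)
  then show ?thesis
  proof eventually_elim
    case (elim \<xi>)
    have "\<bar>average k f \<xi>\<bar> \<le> p k * \<bar>f (\<xi>(k := 1))\<bar> + (1 - p k) * \<bar>f (\<xi>(k := -1))\<bar>"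
      unfolding average_def using p_pos[of k] p_less_1[of k]
      by (intro order_trans[OF abs_triangle_ineq]) (simp add: abs_mult)
    also have "\<dots> \<le> p k * c + (1 - p k) * c"
      using elim p_pos[of k] p_less_1[of k] by (intro add_mono mult_left_mono) auto
    finally show ?case by (simp add: algebra_simps)
  qed
qed

text \<open>The triangle inequality under the two-point sum, followed by
  \<open>integral_average\<close>: averaging contracts the L1 norm, so L1 approximations pass
  through it.\<close>

lemma integral_abs_average_le:
  assumes "integrable M f"
  shows "(\<integral>\<xi>. \<bar>average k f \<xi>\<bar> \<partial>M) \<le> (\<integral>\<xi>. \<bar>f \<xi>\<bar> \<partial>M)"
proof -
  have "(\<integral>\<xi>. \<bar>average k f \<xi>\<bar> \<partial>M) \<le> (\<integral>\<xi>. average k (\<lambda>\<xi>. \<bar>f \<xi>\<bar>) \<xi> \<partial>M)"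
  proof (rule integral_mono)
    show "\<bar>average k f \<xi>\<bar> \<le> average k (\<lambda>\<xi>. \<bar>f \<xi>\<bar>) \<xi>" for \<xi>
      unfolding average_def using p_pos[of k] p_less_1[of k]
      by (intro order_trans[OF abs_triangle_ineq]) (simp add: abs_mult)
  qed (use assms in \<open>auto intro!: integrable_average integrable_abs\<close>)
  then show ?thesis
    using assms by (simp add: integral_average)
qed

text \<open>These are the functions \<open>B\<close> of the overview: stage \<open>n\<close> has
  averaged out the coordinates \<open>0, ..., n - 1\<close>, so it is the conditional expectation
  given the coordinates from \<open>n\<close> on.\<close>

primrec average_upto :: "nat \<Rightarrow> ((nat \<Rightarrow> int) \<Rightarrow> real) \<Rightarrow> (nat \<Rightarrow> int) \<Rightarrow> real" where
  "average_upto 0 f = f"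
| "average_upto (Suc n) f = average n (average_upto n f)"

lemma integrable_average_upto: "integrable M f \<Longrightarrow> integrable M (average_upto n f)"
  by (induction n) (auto intro: integrable_average)

lemma integral_average_upto:
  "integrable M f \<Longrightarrow> (\<integral>\<xi>. average_upto n f \<xi> \<partial>M) = (\<integral>\<xi>. f \<xi> \<partial>M)"
  by (induction n) (auto simp: integral_average integrable_average_upto)

lemma integral_abs_average_upto_le:
  "integrable M f \<Longrightarrow> (\<integral>\<xi>. \<bar>average_upto n f \<xi>\<bar> \<partial>M) \<le> (\<integral>\<xi>. \<bar>f \<xi>\<bar> \<partial>M)"
  by (induction n) (auto intro: order_trans[OF integral_abs_average_le] integrable_average_upto)

lemma AE_abs_average_upto_le:
  "AE \<xi> in M. \<bar>f \<xi>\<bar> \<le> c \<Longrightarrow> AE \<xi> in M. \<bar>average_upto n f \<xi>\<bar> \<le> c"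
  by (induction n) (simp_all add: AE_abs_average_le)

lemma average_upto_add:
  "average_upto n (\<lambda>\<xi>. f \<xi> + g \<xi>) = (\<lambda>\<xi>. average_upto n f \<xi> + average_upto n g \<xi>)"
  by (induction n) (auto simp: average_def algebra_simps)

lemma average_upto_mult:
  "average_upto n (\<lambda>\<xi>. c * f \<xi>) = (\<lambda>\<xi>. c * average_upto n f \<xi>)"
  by (induction n) (auto simp: average_def algebra_simps)

lemma average_upto_diff:
  "average_upto n (\<lambda>\<xi>. f \<xi> - g \<xi>) = (\<lambda>\<xi>. average_upto n f \<xi> - average_upto n g \<xi>)"
  by (induction n) (auto simp: average_def algebra_simps)

lemma average_upto_const: "average_upto n (\<lambda>\<xi>. c) = (\<lambda>\<xi>. c)"
  by (induction n) (auto simp: average_def algebra_simps)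

text \<open>Averaging overwrites a coordinate, so the result no longer depends on it. Once
  \<open>n\<close> exceeds every element of a finite \<open>J\<close>, the average is constant on
  the space.\<close>

lemma average_upto_cong_coordinates:
  assumes "\<And>\<xi> \<eta>. \<xi> \<in> space M \<Longrightarrow> \<eta> \<in> space M \<Longrightarrow> (\<forall>j\<in>J. \<xi> j = \<eta> j) \<Longrightarrow> f \<xi> = f \<eta>"
  shows "\<xi> \<in> space M \<Longrightarrow> \<eta> \<in> space M \<Longrightarrow> (\<forall>j\<in>J - {..<n}. \<xi> j = \<eta> j) \<Longrightarrow>
    average_upto n f \<xi> = average_upto n f \<eta>"
proof (induction n arbitrary: \<xi> \<eta>)
  case 0
  then show ?case using assms[of \<xi> \<eta>] by simp
next
  case (Suc n)
  have "average_upto n f (\<xi>(n := s)) = average_upto n f (\<eta>(n := s))" if "s \<in> {-1, 1}" for s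
    using Suc.prems that
    by (intro Suc.IH ballI update_in_space) (auto simp: less_Suc_eq)
  then show ?case by (simp add: average_def)
qed

section \<open>L1 convergence of the iterated averages to the mean\<close>

definition averages_converge :: "((nat \<Rightarrow> int) \<Rightarrow> real) \<Rightarrow> bool" where
  "averages_converge f \<longleftrightarrow> integrable M f \<and>
     (\<lambda>n. \<integral>\<xi>. \<bar>average_upto n f \<xi> - (\<integral>\<eta>. f \<eta> \<partial>M)\<bar> \<partial>M) \<longlonglongrightarrow> 0"

text \<open>Replacing \<open>f\<close> by \<open>g\<close> costs the L1 distance twice: once for the
  averages, which are L1 contractions, and once for the means. Hence the division of
  \<open>r\<close> into thirds.\<close>

lemma averages_converge_L1_closed:
  assumes f: "integrable M f"
    and approx: "\<And>\<epsilon>. 0 < \<epsilon> \<Longrightarrow> \<exists>g. averages_converge g \<and> (\<integral>\<xi>. \<bar>f \<xi> - g \<xi>\<bar> \<partial>M) < \<epsilon>"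
  shows "averages_converge f"
  unfolding averages_converge_def
proof (intro conjI f LIMSEQ_I)
  fix r :: real assume "0 < r"
  then obtain g where "averages_converge g" and close: "(\<integral>\<xi>. \<bar>f \<xi> - g \<xi>\<bar> \<partial>M) < r / 3"
    using approx[of "r / 3"] by auto
  then have g: "integrable M g"
    and lim: "(\<lambda>n. \<integral>\<xi>. \<bar>average_upto n g \<xi> - (\<integral>\<eta>. g \<eta> \<partial>M)\<bar> \<partial>M) \<longlonglongrightarrow> 0"
    by (auto simp: averages_converge_def)
  let ?h = "\<lambda>\<xi>. f \<xi> - g \<xi>"
  let ?e = "\<lambda>f n. \<integral>\<xi>. \<bar>average_upto n f \<xi> - (\<integral>\<eta>. f \<eta> \<partial>M)\<bar> \<partial>M"
  have le: "?e f n \<le> ?e g n + 2 * (\<integral>\<xi>. \<bar>?h \<xi>\<bar> \<partial>M)" for n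
  proof -
    have "?e f n \<le> (\<integral>\<xi>. \<bar>average_upto n g \<xi> - (\<integral>\<eta>. g \<eta> \<partial>M)\<bar>
        + (\<bar>average_upto n ?h \<xi>\<bar> + \<bar>\<integral>\<eta>. ?h \<eta> \<partial>M\<bar>) \<partial>M)"
      using f g
      by (intro integral_mono)
         (auto intro!: Bochner_Integration.integrable_add integrable_abs Bochner_Integration.integrable_diff
             integrable_average_upto simp: average_upto_diff)
    also have "\<dots> = ?e g n + ((\<integral>\<xi>. \<bar>average_upto n ?h \<xi>\<bar> \<partial>M) + \<bar>\<integral>\<eta>. ?h \<eta> \<partial>M\<bar>)"
    proof -
      have "integrable M (\<lambda>\<xi>. \<bar>average_upto n g \<xi> - (\<integral>\<eta>. g \<eta> \<partial>M)\<bar>)"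
        "integrable M (\<lambda>\<xi>. \<bar>average_upto n ?h \<xi>\<bar>)"
        using f g by (auto intro!: integrable_abs integrable_average_upto)
      then show ?thesis by (simp add: prob_space)
    qed
    also have "\<dots> \<le> ?e g n + ((\<integral>\<xi>. \<bar>?h \<xi>\<bar> \<partial>M) + (\<integral>\<xi>. \<bar>?h \<xi>\<bar> \<partial>M))"
      using f g by (intro add_mono order_refl integral_abs_average_upto_le integral_abs_bound) auto
    finally show ?thesis by simp
  qed
  obtain N where N: "\<And>n. n \<ge> N \<Longrightarrow> norm (?e g n - 0) < r / 3"
    using LIMSEQ_D[OF lim, of "r / 3"] \<open>0 < r\<close> by auto
  have "norm (?e f n - 0) < r" if "n \<ge> N" for n
  proof -
    have "?e f n \<ge> 0" by simp
    then show ?thesis using le[of n] N[OF that] close by simp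
  qed
  then show "\<exists>N. \<forall>n\<ge>N. norm (?e f n - 0) < r" by blast
qed

text \<open>The two functions are at L1 distance zero, so \<open>f\<close> itself serves as the
  approximation in the closure lemma.\<close>

lemma averages_converge_cong:
  assumes "averages_converge f" "\<And>\<xi>. \<xi> \<in> space M \<Longrightarrow> f \<xi> = g \<xi>"
  shows "averages_converge g"
proof (rule averages_converge_L1_closed)
  show "integrable M g"
    using assms by (simp add: averages_converge_def cong: Bochner_Integration.integrable_cong)
  show "\<exists>f. averages_converge f \<and> (\<integral>\<xi>. \<bar>g \<xi> - f \<xi>\<bar> \<partial>M) < \<epsilon>" if "0 < \<epsilon>" for \<epsilon>
    using assms that by (intro exI[of _ f]) (simp cong: Bochner_Integration.integral_cong)
qed

lemma averages_converge_add:
  assumes "averages_converge f" "averages_converge g"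
  shows "averages_converge (\<lambda>\<xi>. f \<xi> + g \<xi>)"
proof -
  have f: "integrable M f" and g: "integrable M g" using assms by (auto simp: averages_converge_def)
  let ?e = "\<lambda>f n. \<integral>\<xi>. \<bar>average_upto n f \<xi> - (\<integral>\<eta>. f \<eta> \<partial>M)\<bar> \<partial>M"
  have "?e (\<lambda>\<xi>. f \<xi> + g \<xi>) n \<le> ?e f n + ?e g n" for n
    using f g
    by (subst Bochner_Integration.integral_add[symmetric])
       (auto intro!: integral_mono Bochner_Integration.integrable_add integrable_abs
         Bochner_Integration.integrable_diff integrable_average_upto simp: average_upto_add)
  moreover have "(\<lambda>n. ?e f n + ?e g n) \<longlonglongrightarrow> 0"
    using assms by (auto simp: averages_converge_def intro: tendsto_add_zero)
  ultimately have "?e (\<lambda>\<xi>. f \<xi> + g \<xi>) \<longlonglongrightarrow> 0"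
    by (intro Lim_null_comparison[OF _ \<open>(\<lambda>n. ?e f n + ?e g n) \<longlonglongrightarrow> 0\<close>] always_eventually) simp
  then show ?thesis using f g by (simp add: averages_converge_def)
qed

lemma averages_converge_cmult:
  assumes "averages_converge f"
  shows "averages_converge (\<lambda>\<xi>. c * f \<xi>)"
proof -
  have f: "integrable M f" using assms by (auto simp: averages_converge_def)
  have "(\<integral>\<xi>. \<bar>average_upto n (\<lambda>\<xi>. c * f \<xi>) \<xi> - (\<integral>\<eta>. c * f \<eta> \<partial>M)\<bar> \<partial>M)
      = \<bar>c\<bar> * (\<integral>\<xi>. \<bar>average_upto n f \<xi> - (\<integral>\<eta>. f \<eta> \<partial>M)\<bar> \<partial>M)" for n
    by (simp add: average_upto_mult abs_mult flip: right_diff_distrib)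
  then show ?thesis
    using assms by (auto simp: averages_converge_def intro: tendsto_mult_right_zero)
qed

lemma averages_converge_const: "averages_converge (\<lambda>\<xi>. c)"
  by (simp add: averages_converge_def average_upto_const prob_space)

text \<open>A cylinder depends on finitely many coordinates. After all of them have been averaged
  out the function is constant, hence equal to its mean, and the error is exactly zero from then
  on.\<close>

lemma averages_converge_cylinder:
  assumes "A \<in> prod_algebra UNIV (\<lambda>k. sign_measure (p k))"
  shows "averages_converge (indicator A)"
proof -
  obtain J E where A: "A = prod_emb UNIV (\<lambda>k. sign_measure (p k)) J (Pi\<^sub>E J E)" and J: "finite J"
    using assms by (elim prod_algebraE) auto
  have [measurable]: "A \<in> sets M"
    using assms by (auto simp: bernoulli_space_def sets_PiM)
  have dep: "(indicator A \<xi> :: real) = indicator A \<eta>"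
    if "\<xi> \<in> space M" "\<eta> \<in> space M" "\<forall>j\<in>J. \<xi> j = \<eta> j" for \<xi> \<eta>
  proof -
    have "restrict \<xi> J = restrict \<eta> J" using that by (auto simp: restrict_def)
    then show ?thesis
      using that by (auto simp: A prod_emb_def indicator_def bernoulli_space_def space_PiM)
  qed
  have int: "integrable M (indicator A :: _ \<Rightarrow> real)"
    by (intro integrable_real_indicator) (auto simp: less_top[symmetric])
  obtain N where N: "J \<subseteq> {..<N}" using J finite_nat_iff_bounded by auto
  have "(\<integral>\<xi>. \<bar>average_upto n (indicator A) \<xi> - (\<integral>\<eta>. indicator A \<eta> \<partial>M)\<bar> \<partial>M) = 0"
    if "n \<ge> N" for n
  proof -
    \<comment> \<open>A reference point that gives a name to the constant value.\<close>
    obtain \<xi>0 where \<xi>0: "\<xi>0 \<in> space M" using not_empty by auto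
    have const: "average_upto n (indicator A) \<xi> = average_upto n (indicator A) \<xi>0"
      if "\<xi> \<in> space M" for \<xi>
      using N \<open>n \<ge> N\<close> that \<xi>0 by (intro average_upto_cong_coordinates[OF dep]) auto
    have "(\<integral>\<xi>. average_upto n (indicator A) \<xi> \<partial>M) = average_upto n (indicator A) \<xi>0"
      using const by (simp add: prob_space cong: Bochner_Integration.integral_cong)
    then have "average_upto n (indicator A) \<xi>0 = (\<integral>\<eta>. indicator A \<eta> \<partial>M)"
      using integral_average_upto[OF int, of n] by simp
    then have "(\<integral>\<xi>. \<bar>average_upto n (indicator A) \<xi> - (\<integral>\<eta>. indicator A \<eta> \<partial>M)\<bar> \<partial>M) = (\<integral>\<xi>. 0 \<partial>M)"
      using const by (intro Bochner_Integration.integral_cong) auto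
    then show ?thesis by simp
  qed
  then have "(\<lambda>n. \<integral>\<xi>. \<bar>average_upto n (indicator A) \<xi> - (\<integral>\<eta>. indicator A \<eta> \<partial>M)\<bar> \<partial>M) \<longlonglongrightarrow> 0"
    by (intro tendsto_eventually) (auto simp: eventually_sequentially)
  then show ?thesis using int by (simp add: averages_converge_def)
qed

text \<open>Dominated convergence upgrades the pointwise limit to an L1 limit, to which L1
  closedness applies.\<close>

lemma averages_converge_limit:
  assumes "\<And>i. averages_converge (s i)" "integrable M w" "f \<in> borel_measurable M"
    and "\<And>\<xi>. \<xi> \<in> space M \<Longrightarrow> (\<lambda>i. s i \<xi>) \<longlonglongrightarrow> f \<xi>"
    and "\<And>i \<xi>. \<xi> \<in> space M \<Longrightarrow> \<bar>s i \<xi>\<bar> \<le> w \<xi>"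
  shows "averages_converge f"
proof (rule averages_converge_L1_closed)
  have s: "integrable M (s i)" for i using assms(1) by (simp add: averages_converge_def)
  have sm: "s i \<in> borel_measurable M" for i using s by (rule borel_measurable_integrable)
  show f: "integrable M f"
  proof (rule integrable_dominated_convergence)
    show "AE \<xi> in M. (\<lambda>i. s i \<xi>) \<longlonglongrightarrow> f \<xi>" by (rule AE_I2) (rule assms(4))
    show "AE \<xi> in M. norm (s i \<xi>) \<le> w \<xi>" for i using assms(5) by (intro AE_I2) simp
  qed fact+
  have "(\<lambda>i. \<integral>\<xi>. \<bar>f \<xi> - s i \<xi>\<bar> \<partial>M) \<longlonglongrightarrow> (\<integral>\<xi>. 0 \<partial>M)"
  proof (rule integral_dominated_convergence[where w = "\<lambda>\<xi>. \<bar>f \<xi>\<bar> + w \<xi>"])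
    show "AE \<xi> in M. (\<lambda>i. \<bar>f \<xi> - s i \<xi>\<bar>) \<longlonglongrightarrow> 0"
    proof (rule AE_I2)
      fix \<xi> assume "\<xi> \<in> space M"
      then have "(\<lambda>i. \<bar>f \<xi> - s i \<xi>\<bar>) \<longlonglongrightarrow> \<bar>f \<xi> - f \<xi>\<bar>"
        by (intro tendsto_intros assms(4))
      then show "(\<lambda>i. \<bar>f \<xi> - s i \<xi>\<bar>) \<longlonglongrightarrow> 0" by simp
    qed
    show "AE \<xi> in M. norm \<bar>f \<xi> - s i \<xi>\<bar> \<le> \<bar>f \<xi>\<bar> + w \<xi>" for i
    proof (rule AE_I2)
      fix \<xi> assume "\<xi> \<in> space M"
      then show "norm \<bar>f \<xi> - s i \<xi>\<bar> \<le> \<bar>f \<xi>\<bar> + w \<xi>" using assms(5)[of \<xi> i] by simp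
    qed
    show "integrable M (\<lambda>\<xi>. \<bar>f \<xi>\<bar> + w \<xi>)"
      using f assms(2) by (intro Bochner_Integration.integrable_add integrable_abs)
    show "(\<lambda>\<xi>. \<bar>f \<xi> - s i \<xi>\<bar>) \<in> borel_measurable M" for i
      using sm assms(3) by measurable
  qed simp
  then have "eventually (\<lambda>i. (\<integral>\<xi>. \<bar>f \<xi> - s i \<xi>\<bar> \<partial>M) < \<epsilon>) sequentially" if "0 < \<epsilon>" for \<epsilon>
    using that by (auto intro: order_tendstoD)
  then show "\<exists>g. averages_converge g \<and> (\<integral>\<xi>. \<bar>f \<xi> - g \<xi>\<bar> \<partial>M) < \<epsilon>" if "0 < \<epsilon>" for \<epsilon>
    using that assms(1) by (meson eventually_happens' sequentially_bot)
qed

text \<open>Dynkin's pi-lambda argument: cylinders form an intersection-stable generator, and a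
  countable disjoint union is the limit of its finite partial unions, whose indicators are dominated
  by 1.\<close>

lemma averages_converge_indicator:
  assumes "A \<in> sets M"
  shows "averages_converge (indicator A)"
proof -
  let ?G = "prod_algebra UNIV (\<lambda>k. sign_measure (p k))"
  have sets_eq: "sets M = sigma_sets (space M) ?G"
    unfolding bernoulli_space_def sets_PiM space_PiM ..
  have G: "?G \<subseteq> Pow (space M)"
    unfolding bernoulli_space_def space_PiM by (rule prod_algebra_sets_into_space)
  have "A \<in> sigma_sets (space M) ?G"
    using assms unfolding sets_eq .
  then show ?thesis
  proof (rule sigma_sets_induct_disjoint[OF Int_stable_prod_algebra G])
    show "averages_converge (indicator A)" if "A \<in> ?G" for A
      using that by (rule averages_converge_cylinder)
    have zero: "indicator {} = (\<lambda>\<xi> :: nat \<Rightarrow> int. 0 :: real)" by auto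
    show "averages_converge (indicator {})"
      unfolding zero by (rule averages_converge_const)
    \<comment> \<open>The indicator of the complement equals one minus that of \<open>A\<close> on
      the space only, hence the use of \<open>averages_converge_cong\<close>.\<close>
    show "averages_converge (indicator (space M - A))" if "averages_converge (indicator A)" for A
    proof (rule averages_converge_cong)
      show "averages_converge (\<lambda>\<xi>. 1 + (-1) * indicator A \<xi>)"
        by (intro averages_converge_add averages_converge_const averages_converge_cmult that)
    qed (auto simp: indicator_def)
    fix A :: "nat \<Rightarrow> (nat \<Rightarrow> int) set"
    assume disj: "disjoint_family A" and sets: "range A \<subseteq> sigma_sets (space M) ?G"
      and erg: "\<And>i. averages_converge (indicator (A i))"
    have A: "A i \<in> sets M" for i using sets unfolding sets_eq by auto
    have partial: "averages_converge (indicator (\<Union>i<n. A i))" for n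
    proof (induction n)
      case 0
      show ?case using averages_converge_const[of 0] by (simp add: zero)
    next
      case (Suc n)
      have "A n \<inter> (\<Union>i<n. A i) = {}"
        using disjoint_family_onD[OF disj, of n] by fastforce
      then have "(indicator (\<Union>i<Suc n. A i) :: _ \<Rightarrow> real)
          = (\<lambda>\<xi>. indicator (A n) \<xi> + indicator (\<Union>i<n. A i) \<xi>)"
        by (simp add: lessThan_Suc indicator_add)
      then show ?case using averages_converge_add[OF erg[of n] Suc] by simp
    qed
    show "averages_converge (indicator (\<Union>i. A i))"
    proof (rule averages_converge_limit[OF partial, where w = "\<lambda>_. 1"])
      show "indicator (\<Union>i. A i) \<in> borel_measurable M"
        using A by (intro borel_measurable_indicator sets.countable_UN) auto
      show "(\<lambda>n. indicator (\<Union>i<n. A i) \<xi> :: real) \<longlonglongrightarrow> indicator (\<Union>i. A i) \<xi>" for \<xi>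
        by (rule LIMSEQ_indicator_UN)
    qed (simp_all add: indicator_def)
  qed
qed

text \<open>Density takes the place of backward martingale convergence and Kolmogorov's zero-one
  law: the property passes from indicators to sums and dominated limits, which exhausts the
  integrable functions.\<close>

theorem average_upto_tendsto_L1:
  assumes "integrable M f"
  shows "(\<lambda>n. \<integral>\<xi>. \<bar>average_upto n f \<xi> - (\<integral>\<eta>. f \<eta> \<partial>M)\<bar> \<partial>M) \<longlonglongrightarrow> 0"
proof -
  have "averages_converge f"
    using assms
  proof induction
    case (base A c)
    then show ?case
      using averages_converge_cmult[OF averages_converge_indicator, of A c] by (simp add: mult.commute)
  next
    case (add f g)
    then show ?case by (intro averages_converge_add)
  next
    case (lim f s)
    show ?case
    proof (rule averages_converge_limit[OF lim.IH])
      \<comment> \<open>The factor 2 is the domination constant that the induction rule provides for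
        the approximating sequence.\<close>
      show "integrable M (\<lambda>\<xi>. 2 * \<bar>f \<xi>\<bar>)"
        using lim.hyps(4) by (intro integrable_mult_right integrable_abs)
      show "f \<in> borel_measurable M"
        using lim.hyps(4) by (rule borel_measurable_integrable)
      show "\<bar>s i \<xi>\<bar> \<le> 2 * \<bar>f \<xi>\<bar>" if "\<xi> \<in> space M" for i \<xi>
        using lim.hyps(3)[OF that, of i] by simp
    qed (rule lim.hyps(2))
  qed
  then show ?thesis by (simp add: averages_converge_def)
qed

end

subsection \<open>Laplace transforms of bounded random variables\<close>

text \<open>Two applications of \<open>1 + y \<le> exp y\<close> give first
  \<open>exp x - 1 - x \<le> x * (exp x - 1)\<close> and then the quadratic bound. It controls the
  remainder when the Laplace transform is differentiated under the integral.\<close>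

lemma abs_exp_minus_1_minus_le:
  fixes x :: real
  shows "\<bar>exp x - 1 - x\<bar> \<le> x\<^sup>2 * exp \<bar>x\<bar>"
proof -
  have "0 \<le> exp x - 1 - x" using exp_ge_add_one_self[of x] by linarith
  moreover have *: "exp y * (1 - y) \<le> 1" for y :: real
    using exp_ge_add_one_self[of "-y"] by (simp add: exp_minus field_simps)
  then have "exp x - 1 - x \<le> x * (exp x - 1)"
    by (simp add: algebra_simps)
  moreover have "x * (exp x - 1) \<le> x\<^sup>2 * exp \<bar>x\<bar>"
  proof (cases "x \<ge> 0")
    case True
    then have "x * (exp x - 1) \<le> x * (x * exp x)"
      using *[of x] by (intro mult_left_mono) (auto simp: algebra_simps)
    then show ?thesis using True by (simp add: power2_eq_square algebra_simps)
  next
    case False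
    then have "- x * (1 - exp x) \<le> - x * (- x)"
      using exp_ge_add_one_self[of x] by (intro mult_left_mono) linarith+
    also have "\<dots> \<le> x\<^sup>2 * exp \<bar>x\<bar>"
      using mult_left_mono[of 1 "exp \<bar>x\<bar>" "x\<^sup>2"] by (simp add: power2_eq_square)
    finally show ?thesis by (simp add: algebra_simps)
  qed
  ultimately show ?thesis by linarith
qed

text \<open>By convexity the mean of \<open>exp\<close> over an interval is at most the mean of its
  endpoint values. Factoring out \<open>exp b\<close> reduces this to one variable, where a
  derivative test settles it. The division by 2 accounts for the 2 in the gradient weights.\<close>

lemma abs_exp_diff_le:
  fixes a b :: real
  shows "\<bar>exp a - exp b\<bar> \<le> \<bar>a - b\<bar> * ((exp a + exp b) / 2)"
proof -
  have *: "exp x - 1 \<le> x * ((exp x + 1) / 2)" if "0 \<le> x" for x :: real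
  proof -
    let ?g = "\<lambda>x::real. x * (exp x + 1) - 2 * (exp x - 1)"
    have "?g 0 \<le> ?g x"
    proof (rule DERIV_nonneg_imp_nondecreasing[OF that])
      fix y :: real
      have "(?g has_real_derivative (y * exp y + 1 - exp y)) (at y)"
        by (auto intro!: derivative_eq_intros simp: algebra_simps)
      moreover have "exp y * (1 - y) \<le> 1"
        using exp_ge_add_one_self[of "-y"] by (simp add: exp_minus field_simps)
      ultimately show "\<exists>z. (?g has_real_derivative z) (at y) \<and> z \<ge> 0"
        by (intro exI[of _ "y * exp y + 1 - exp y"]) (auto simp: algebra_simps)
    qed
    then show ?thesis by simp
  qed
  have le: "exp a - exp b \<le> (a - b) * ((exp a + exp b) / 2)" if "b \<le> a" for a b :: real
  proof -
    have "exp b * (exp (a - b) - 1) \<le> exp b * ((a - b) * ((exp (a - b) + 1) / 2))"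
      using * that by (intro mult_left_mono) auto
    moreover define y where "y = exp (a - b)"
    moreover have "exp a = exp b * y" by (simp add: y_def flip: exp_add)
    ultimately show ?thesis by (simp add: algebra_simps)
  qed
  show ?thesis
    using le[of a b] le[of b a] by (cases a b rule: linorder_cases) (auto simp: algebra_simps)
qed

context prob_space
begin

text \<open>Differentiation under the integral: boundedness of \<open>Z\<close> makes the pointwise
  Taylor remainder at most a constant times the square of \<open>h\<close>, uniformly in the sample
  point.\<close>

lemma has_derivative_mgf:
  fixes Z :: "'a \<Rightarrow> real"
  assumes [measurable]: "Z \<in> borel_measurable M" and B: "\<And>x. \<bar>Z x\<bar> \<le> B"
  shows "((\<lambda>s. \<integral>x. exp (s * Z x) \<partial>M) has_real_derivative (\<integral>x. Z x * exp (s * Z x) \<partial>M)) (at s)"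
proof -
  have B0: "0 \<le> B" using B[of undefined] by linarith
  have exp_le: "exp (t * Z x) \<le> exp (\<bar>t\<bar> * B)" for t x
  proof -
    have "t * Z x \<le> \<bar>t\<bar> * \<bar>Z x\<bar>" by (simp flip: abs_mult)
    also have "\<dots> \<le> \<bar>t\<bar> * B" using B by (intro mult_left_mono) auto
    finally show ?thesis by simp
  qed
  have int_exp: "integrable M (\<lambda>x. exp (t * Z x))" for t
    using exp_le by (intro integrable_const_bound[where B = "exp (\<bar>t\<bar> * B)"]) auto
  have int_Z: "integrable M (\<lambda>x. Z x * exp (t * Z x))" for t
  proof (intro integrable_const_bound[where B = "B * exp (\<bar>t\<bar> * B)"] AE_I2)
    fix x
    show "norm (Z x * exp (t * Z x)) \<le> B * exp (\<bar>t\<bar> * B)"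
      unfolding real_norm_def abs_mult abs_exp_cancel
      using B0 by (intro mult_mono B exp_le) auto
  qed simp
  let ?\<phi> = "\<lambda>s. \<integral>x. exp (s * Z x) \<partial>M"
  \<comment> \<open>The first factor bounds \<open>exp (s * Z x)\<close>; the second bounds the
    remainder divided by the square of \<open>h\<close>, using
    \<open>\<bar>h\<bar> \<le> 1\<close>.\<close>
  let ?C = "exp (\<bar>s\<bar> * B) * (B\<^sup>2 * exp B)"
  have bound: "\<bar>?\<phi> (s + h) - ?\<phi> s - h * (\<integral>x. Z x * exp (s * Z x) \<partial>M)\<bar> \<le> h\<^sup>2 * ?C"
    if h: "\<bar>h\<bar> \<le> 1" for h
  proof -
    let ?f = "\<lambda>x. exp ((s + h) * Z x) - exp (s * Z x) - h * (Z x * exp (s * Z x))"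
    have "\<bar>?\<phi> (s + h) - ?\<phi> s - h * (\<integral>x. Z x * exp (s * Z x) \<partial>M)\<bar> = \<bar>\<integral>x. ?f x \<partial>M\<bar>"
      using int_exp int_Z by simp
    also have "\<dots> \<le> (\<integral>x. \<bar>?f x\<bar> \<partial>M)"
      by (rule integral_abs_bound)
    also have "\<dots> \<le> (\<integral>x. h\<^sup>2 * ?C \<partial>M)"
    proof (rule integral_mono)
      fix x
      have f_eq: "?f x = exp (s * Z x) * (exp (h * Z x) - 1 - h * Z x)"
        unfolding distrib_right exp_add by (simp add: algebra_simps)
      have "\<bar>?f x\<bar> = exp (s * Z x) * \<bar>exp (h * Z x) - 1 - h * Z x\<bar>"
        unfolding f_eq abs_mult by simp
      also have "\<dots> \<le> exp (s * Z x) * ((h * Z x)\<^sup>2 * exp \<bar>h * Z x\<bar>)"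
        by (intro mult_left_mono abs_exp_minus_1_minus_le) simp
      also have "\<dots> \<le> exp (\<bar>s\<bar> * B) * ((h\<^sup>2 * B\<^sup>2) * exp B)"
      proof (intro mult_mono exp_le)
        show "(h * Z x)\<^sup>2 \<le> h\<^sup>2 * B\<^sup>2"
          unfolding power_mult_distrib
          using B[of x] by (intro mult_left_mono) (auto simp: abs_le_square_iff[symmetric] B0)
        have "\<bar>h * Z x\<bar> \<le> 1 * B"
          unfolding abs_mult using h B[of x] by (intro mult_mono) auto
        then show "exp \<bar>h * Z x\<bar> \<le> exp B" by simp
      qed auto
      finally show "\<bar>?f x\<bar> \<le> h\<^sup>2 * ?C" by (simp add: algebra_simps)
    qed (use int_exp int_Z in auto)
    finally show ?thesis by (simp add: prob_space)
  qed
  show ?thesis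
    unfolding DERIV_def
  proof (rule LIM_zero_cancel, rule Lim_null_comparison)
    show "((\<lambda>h. \<bar>h\<bar> * ?C) \<longlongrightarrow> 0) (at 0)"
      by (auto intro!: tendsto_eq_intros)
    have "eventually (\<lambda>h::real. h \<noteq> 0 \<and> \<bar>h\<bar> \<le> 1) (at 0)"
      unfolding eventually_at by (intro exI[of _ 1]) auto
    then show "\<forall>\<^sub>F h in at 0. norm ((?\<phi> (s + h) - ?\<phi> s) / h - (\<integral>x. Z x * exp (s * Z x) \<partial>M)) \<le> \<bar>h\<bar> * ?C"
    proof eventually_elim
      case (elim h)
      then have "norm ((?\<phi> (s + h) - ?\<phi> s) / h - (\<integral>x. Z x * exp (s * Z x) \<partial>M))
          = \<bar>?\<phi> (s + h) - ?\<phi> s - h * (\<integral>x. Z x * exp (s * Z x) \<partial>M)\<bar> / \<bar>h\<bar>"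
        by (simp add: field_simps flip: abs_divide)
      also have "\<dots> \<le> h\<^sup>2 * ?C / \<bar>h\<bar>"
        using bound elim by (intro divide_right_mono) auto
      also have "\<dots> = \<bar>h\<bar> * ?C"
        using elim by (simp add: power2_eq_square field_simps abs_mult_self)
      finally show ?case .
    qed
  qed
qed

text \<open>A Gronwall argument: dividing the Laplace transform by the Gaussian solution of the
  differential inequality leaves a nonincreasing function, whose value at 0 is 1.\<close>

lemma mgf_le_gaussian:
  fixes Z :: "'a \<Rightarrow> real"
  assumes "Z \<in> borel_measurable M" "\<And>x. \<bar>Z x\<bar> \<le> B"
    and herbst: "\<And>s. 0 \<le> s \<Longrightarrow> (\<integral>x. Z x * exp (s * Z x) \<partial>M) \<le> s * v * (\<integral>x. exp (s * Z x) \<partial>M)"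
    and "0 \<le> s"
  shows "(\<integral>x. exp (s * Z x) \<partial>M) \<le> exp (s\<^sup>2 * v / 2)"
proof -
  let ?\<phi> = "\<lambda>s. \<integral>x. exp (s * Z x) \<partial>M"
  let ?g = "\<lambda>s. ?\<phi> s * exp (- (s\<^sup>2 * v / 2))"
  have "?g s \<le> ?g 0"
  proof (rule DERIV_nonpos_imp_nonincreasing[OF \<open>0 \<le> s\<close>])
    fix t :: real assume "0 \<le> t"
    let ?d = "((\<integral>x. Z x * exp (t * Z x) \<partial>M) - t * v * ?\<phi> t) * exp (- (t\<^sup>2 * v / 2))"
    have "(?g has_real_derivative ?d) (at t)"
      by (auto intro!: derivative_eq_intros has_derivative_mgf[OF assms(1,2)] simp: algebra_simps)
    moreover have "?d \<le> 0"
      using herbst[OF \<open>0 \<le> t\<close>] by (intro mult_nonpos_nonneg) auto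
    ultimately show "\<exists>y. (?g has_real_derivative y) (at t) \<and> y \<le> 0" by blast
  qed
  then show ?thesis by (simp add: prob_space exp_minus field_simps)
qed

lemma integrable_mult_AE_bounded:
  fixes f g :: "'a \<Rightarrow> real"
  assumes "integrable M f" "g \<in> borel_measurable M" "AE x in M. \<bar>g x\<bar> \<le> C"
  shows "integrable M (\<lambda>x. f x * g x)"
proof (rule Bochner_Integration.integrable_bound)
  show "integrable M (\<lambda>x. C * f x)" using assms(1) by simp
  show "(\<lambda>x. f x * g x) \<in> borel_measurable M" using assms(1,2) by measurable
  show "AE x in M. norm (f x * g x) \<le> norm (C * f x)"
    using assms(3)
  proof eventually_elim
    case (elim x)
    then have "\<bar>f x\<bar> * \<bar>g x\<bar> \<le> \<bar>f x\<bar> * \<bar>C\<bar>" by (intro mult_left_mono) auto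
    then show ?case by (simp add: abs_mult mult.commute)
  qed
qed

end

subsection \<open>Covariance and gradients\<close>

context biased_signs
begin

abbreviation "D \<equiv> discrete_gradient p"

lemma gradient_average: "j \<noteq> k \<Longrightarrow> D k (average j f) = average j (D k f)"
  by (simp add: fun_eq_iff discrete_gradient_def average_def fun_upd_twist[of j k] algebra_simps)

text \<open>Only coordinates below \<open>n\<close> have been averaged, and these differ from
  \<open>k\<close>. The case \<open>n = k\<close> is the one that identifies the gradient of a
  martingale increment.\<close>

lemma gradient_average_upto: "n \<le> k \<Longrightarrow> D k (average_upto n f) = average_upto n (D k f)"
  by (induction n) (auto simp: gradient_average)

text \<open>The left-hand side is the conditional covariance in the \<open>k\<close>-th coordinate.
  For a two-point law it equals \<open>p k * (1 - p k)\<close> times the product of the increments;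
  the square roots in the two gradients supply this factor.\<close>

lemma average_mult_centered:
  "average k (\<lambda>\<xi>. (f \<xi> - average k f \<xi>) * g \<xi>) = (\<lambda>\<xi>. D k f \<xi> * D k g \<xi>)"
proof
  fix \<xi>
  have "sqrt (p k * (1 - p k)) * sqrt (p k * (1 - p k)) = p k * (1 - p k)"
    using p_pos[of k] p_less_1[of k] by simp
  then have "D k f \<xi> * D k g \<xi> = p k * (1 - p k)
      * ((f (\<xi>(k := 1)) - f (\<xi>(k := -1))) * (g (\<xi>(k := 1)) - g (\<xi>(k := -1))))"
    by (simp add: discrete_gradient_def)
  then show "average k (\<lambda>\<xi>. (f \<xi> - average k f \<xi>) * g \<xi>) \<xi> = D k f \<xi> * D k g \<xi>"
    by (simp add: average_def algebra_simps)
qed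

lemma borel_measurable_gradient [measurable]:
  "f \<in> borel_measurable M \<Longrightarrow> D k f \<in> borel_measurable M"
  unfolding discrete_gradient_def[abs_def] by measurable auto

lemma integrable_gradient: "integrable M f \<Longrightarrow> integrable M (D k f)"
  unfolding discrete_gradient_def[abs_def]
  using integrable_update[of f 1 k] integrable_update[of f "-1" k] by auto

text \<open>Averaging over coordinate \<open>k\<close> preserves the integral and turns the
  integrand into a product of gradients, to which Hoelder's inequality applies.\<close>

lemma covariance_step:
  assumes f: "integrable M f" and g: "integrable M g" "AE \<xi> in M. \<bar>g \<xi>\<bar> \<le> C"
    and c: "AE \<xi> in M. \<bar>D k f \<xi>\<bar> \<le> c"
  shows "(\<integral>\<xi>. (f \<xi> - average k f \<xi>) * g \<xi> \<partial>M) \<le> c * (\<integral>\<xi>. \<bar>D k g \<xi>\<bar> \<partial>M)"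
proof -
  have "integrable M (\<lambda>\<xi>. (f \<xi> - average k f \<xi>) * g \<xi>)"
    using f g by (intro integrable_mult_AE_bounded[where C = C] Bochner_Integration.integrable_diff
      integrable_average borel_measurable_integrable)
  then have "(\<integral>\<xi>. (f \<xi> - average k f \<xi>) * g \<xi> \<partial>M) = (\<integral>\<xi>. D k f \<xi> * D k g \<xi> \<partial>M)"
    unfolding average_mult_centered[symmetric] by (rule integral_average[symmetric])
  also have "\<dots> \<le> (\<integral>\<xi>. c * \<bar>D k g \<xi>\<bar> \<partial>M)"
  proof (rule integral_mono_AE)
    show "integrable M (\<lambda>\<xi>. D k f \<xi> * D k g \<xi>)"
      using integrable_mult_AE_bounded[OF integrable_gradient[OF g(1), of k]
        borel_measurable_gradient[OF borel_measurable_integrable[OF f]] c]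
      by (simp add: mult.commute)
    show "integrable M (\<lambda>\<xi>. c * \<bar>D k g \<xi>\<bar>)"
      using g by (intro integrable_mult_right integrable_abs integrable_gradient)
    show "AE \<xi> in M. D k f \<xi> * D k g \<xi> \<le> c * \<bar>D k g \<xi>\<bar>"
      using c
    proof eventually_elim
      case (elim \<xi>)
      have "D k f \<xi> * D k g \<xi> \<le> \<bar>D k f \<xi>\<bar> * \<bar>D k g \<xi>\<bar>" by (simp flip: abs_mult)
      also have "\<dots> \<le> c * \<bar>D k g \<xi>\<bar>" using elim by (intro mult_right_mono) auto
      finally show ?case .
    qed
  qed
  finally show ?thesis by simp
qed

text \<open>The difference telescopes into one-coordinate increments. The gradient of the
  \<open>k\<close>-th stage is an average of \<open>D k f\<close>, so it inherits the bound
  \<open>c k\<close>.\<close>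

lemma covariance_average_upto_le:
  assumes f: "integrable M f" and g: "integrable M g" "AE \<xi> in M. \<bar>g \<xi>\<bar> \<le> C"
    and c: "\<And>k. AE \<xi> in M. \<bar>D k f \<xi>\<bar> \<le> c k"
  shows "(\<integral>\<xi>. (f \<xi> - average_upto n f \<xi>) * g \<xi> \<partial>M) \<le> (\<Sum>k<n. c k * (\<integral>\<xi>. \<bar>D k g \<xi>\<bar> \<partial>M))"
proof (induction n)
  case (Suc n)
  let ?h = "average_upto n f"
  have h: "integrable M ?h" by (rule integrable_average_upto[OF f])
  have "(f \<xi> - average_upto (Suc n) f \<xi>) * g \<xi>
      = (f \<xi> - ?h \<xi>) * g \<xi> + (?h \<xi> - average n ?h \<xi>) * g \<xi>" for \<xi>
    by (simp add: algebra_simps)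
  then have "(\<integral>\<xi>. (f \<xi> - average_upto (Suc n) f \<xi>) * g \<xi> \<partial>M)
      = (\<integral>\<xi>. (f \<xi> - ?h \<xi>) * g \<xi> + (?h \<xi> - average n ?h \<xi>) * g \<xi> \<partial>M)"
    by presburger
  also have "\<dots> = (\<integral>\<xi>. (f \<xi> - ?h \<xi>) * g \<xi> \<partial>M) + (\<integral>\<xi>. (?h \<xi> - average n ?h \<xi>) * g \<xi> \<partial>M)"
    using f g h
    by (intro Bochner_Integration.integral_add integrable_mult_AE_bounded[where C = C]
      Bochner_Integration.integrable_diff integrable_average borel_measurable_integrable)
  also have "(\<integral>\<xi>. (?h \<xi> - average n ?h \<xi>) * g \<xi> \<partial>M) \<le> c n * (\<integral>\<xi>. \<bar>D n g \<xi>\<bar> \<partial>M)"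
    using h g
  proof (rule covariance_step)
    show "AE \<xi> in M. \<bar>D n ?h \<xi>\<bar> \<le> c n"
      unfolding gradient_average_upto[OF order_refl] by (intro AE_abs_average_upto_le c)
  qed
  finally show ?case using Suc.IH by simp
qed simp

text \<open>The trapezoidal bound weights both endpoints equally, whereas averaging uses
  \<open>p k\<close> and \<open>1 - p k\<close>; dividing by the smaller probability makes up for
  the mismatch. The average then disappears under the integral.\<close>

lemma integral_abs_gradient_exp_le:
  assumes f: "f \<in> borel_measurable M" "\<And>\<xi>. \<bar>f \<xi>\<bar> \<le> C" and "0 \<le> s"
  shows "(\<integral>\<xi>. \<bar>D k (\<lambda>\<xi>. exp (s * f \<xi>)) \<xi>\<bar> \<partial>M)
    \<le> s * (\<integral>\<xi>. 1 / (2 * min (p k) (1 - p k)) * \<bar>D k f \<xi>\<bar> * exp (s * f \<xi>) \<partial>M)"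
proof -
  define m where "m = min (p k) (1 - p k)"
  have m: "0 < m" "m \<le> p k" "m \<le> 1 - p k" using p_pos[of k] p_less_1[of k] by (auto simp: m_def)
  let ?g = "\<lambda>\<xi>. exp (s * f \<xi>)"
  let ?h = "\<lambda>\<xi>. 1 / (2 * m) * \<bar>D k f \<xi>\<bar> * ?g \<xi>"
  have int_f: "integrable M f"
    using f by (intro integrable_const_bound[where B = C]) auto
  have g_le: "\<bar>?g \<xi>\<bar> \<le> exp (s * C)" for \<xi>
    using f(2)[of \<xi>] \<open>0 \<le> s\<close> by (auto intro!: mult_left_mono)
  have int_g: "integrable M ?g"
    using f g_le by (intro integrable_const_bound[where B = "exp (s * C)"]) auto
  have int_h: "integrable M ?h"
    using g_le
    by (intro integrable_mult_AE_bounded[where C = "exp (s * C)"] integrable_mult_right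
      integrable_abs integrable_gradient int_f borel_measurable_integrable int_g AE_I2)
  have "\<bar>D k ?g \<xi>\<bar> \<le> s * average k ?h \<xi>" for \<xi>
  proof -
    let ?a = "f (\<xi>(k := 1))" and ?b = "f (\<xi>(k := -1))"
    let ?r = "sqrt (p k * (1 - p k))"
    have r: "0 \<le> ?r" using p_pos[of k] p_less_1[of k] by simp
    have "\<bar>D k ?g \<xi>\<bar> = ?r * \<bar>exp (s * ?a) - exp (s * ?b)\<bar>"
      using r by (simp add: discrete_gradient_def abs_mult)
    also have "\<dots> \<le> ?r * (\<bar>s * ?a - s * ?b\<bar> * ((exp (s * ?a) + exp (s * ?b)) / 2))"
      using r by (intro mult_left_mono abs_exp_diff_le)
    also have "\<dots> = s * (\<bar>D k f \<xi>\<bar> / 2) * (exp (s * ?a) + exp (s * ?b))"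
      using \<open>0 \<le> s\<close> r by (simp add: discrete_gradient_def abs_mult flip: right_diff_distrib)
    also have "\<dots> \<le> s * (\<bar>D k f \<xi>\<bar> / 2) * (p k / m * exp (s * ?a) + (1 - p k) / m * exp (s * ?b))"
    proof (intro mult_left_mono add_mono)
      show "exp (s * ?a) \<le> p k / m * exp (s * ?a)" "exp (s * ?b) \<le> (1 - p k) / m * exp (s * ?b)"
        using m mult_right_mono[of 1 "p k / m" "exp (s * ?a)"]
          mult_right_mono[of 1 "(1 - p k) / m" "exp (s * ?b)"] by simp_all
    qed (use \<open>0 \<le> s\<close> in auto)
    \<comment> \<open>\<open>D k f\<close> does not depend on the \<open>k\<close>-th coordinate, so
      it may be moved inside the average.\<close>
    also have "\<dots> = s * average k ?h \<xi>"
      using m by (simp add: average_def discrete_gradient_def field_simps)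
    finally show ?thesis .
  qed
  then have "(\<integral>\<xi>. \<bar>D k ?g \<xi>\<bar> \<partial>M) \<le> (\<integral>\<xi>. s * average k ?h \<xi> \<partial>M)"
    by (intro integral_mono integrable_abs integrable_gradient int_g integrable_mult_right
      integrable_average int_h)
  also have "\<dots> = s * (\<integral>\<xi>. ?h \<xi> \<partial>M)"
    using integral_average[OF int_h] by simp
  finally show ?thesis by (simp add: m_def)
qed

text \<open>The covariance bound is proved with the \<open>n\<close>-th average in place of the
  mean, where only finite sums occur, and then \<open>n\<close> tends to infinity.\<close>

lemma herbst_inequality:
  assumes f: "f \<in> borel_measurable M" "\<And>\<xi>. \<bar>f \<xi>\<bar> \<le> C"
    and c: "\<And>k. AE \<xi> in M. \<bar>D k f \<xi>\<bar> \<le> c k" "\<And>k. 0 \<le> c k"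
    and v: "\<And>n. AE \<xi> in M. (\<Sum>k<n. 1 / (2 * min (p k) (1 - p k)) * \<bar>D k f \<xi>\<bar> * c k) \<le> v"
    and "0 \<le> s"
  shows "(\<integral>\<xi>. (f \<xi> - (\<integral>\<eta>. f \<eta> \<partial>M)) * exp (s * f \<xi>) \<partial>M) \<le> s * v * (\<integral>\<xi>. exp (s * f \<xi>) \<partial>M)"
proof -
  let ?g = "\<lambda>\<xi>. exp (s * f \<xi>)"
  let ?w = "\<lambda>k. 1 / (2 * min (p k) (1 - p k))"
  have int_f: "integrable M f"
    using f by (intro integrable_const_bound[where B = C]) auto
  have g_le: "\<bar>?g \<xi>\<bar> \<le> exp (s * C)" for \<xi>
    using f(2)[of \<xi>] \<open>0 \<le> s\<close> by (auto intro!: mult_left_mono)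
  then have AE_g: "AE \<xi> in M. \<bar>?g \<xi>\<bar> \<le> exp (s * C)" by simp
  have int_g: "integrable M ?g"
    using f g_le by (intro integrable_const_bound[where B = "exp (s * C)"]) auto
  note int_prod = integrable_mult_AE_bounded[OF _ borel_measurable_integrable[OF int_g] AE_g]
  have upto: "(\<integral>\<xi>. (f \<xi> - average_upto n f \<xi>) * ?g \<xi> \<partial>M) \<le> s * v * (\<integral>\<xi>. ?g \<xi> \<partial>M)" for n
  proof -
    have int_k: "integrable M (\<lambda>\<xi>. ?w k * \<bar>D k f \<xi>\<bar> * ?g \<xi>)" for k
      by (intro int_prod integrable_mult_right integrable_abs integrable_gradient int_f)
    have "(\<integral>\<xi>. (f \<xi> - average_upto n f \<xi>) * ?g \<xi> \<partial>M)
        \<le> (\<Sum>k<n. c k * (\<integral>\<xi>. \<bar>D k ?g \<xi>\<bar> \<partial>M))"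
      by (rule covariance_average_upto_le[OF int_f int_g AE_g c(1)])
    also have "\<dots> \<le> (\<Sum>k<n. c k * (s * (\<integral>\<xi>. ?w k * \<bar>D k f \<xi>\<bar> * ?g \<xi> \<partial>M)))"
      using f \<open>0 \<le> s\<close>
      by (intro sum_mono mult_left_mono integral_abs_gradient_exp_le[where C = C] c(2))
    also have "\<dots> = s * (\<Sum>k<n. c k * (\<integral>\<xi>. ?w k * \<bar>D k f \<xi>\<bar> * ?g \<xi> \<partial>M))"
      by (simp add: sum_distrib_left mult_ac)
    also have "\<dots> = s * (\<Sum>k<n. (\<integral>\<xi>. c k * (?w k * \<bar>D k f \<xi>\<bar> * ?g \<xi>) \<partial>M))"
      by simp
    also have "\<dots> = s * (\<integral>\<xi>. (\<Sum>k<n. c k * (?w k * \<bar>D k f \<xi>\<bar> * ?g \<xi>)) \<partial>M)"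
      by (intro arg_cong[where f = "(*) s"] Bochner_Integration.integral_sum[symmetric]
        integrable_mult_right int_k)
    also have "\<dots> \<le> s * (\<integral>\<xi>. v * ?g \<xi> \<partial>M)"
    proof (intro mult_left_mono \<open>0 \<le> s\<close> integral_mono_AE)
      show "integrable M (\<lambda>\<xi>. \<Sum>k<n. c k * (?w k * \<bar>D k f \<xi>\<bar> * ?g \<xi>))"
        by (intro Bochner_Integration.integrable_sum integrable_mult_right int_k)
      show "integrable M (\<lambda>\<xi>. v * ?g \<xi>)" using int_g by (rule integrable_mult_right)
      show "AE \<xi> in M. (\<Sum>k<n. c k * (?w k * \<bar>D k f \<xi>\<bar> * ?g \<xi>)) \<le> v * ?g \<xi>"
        using v[of n]
      proof eventually_elim
        case (elim \<xi>)
        have "(\<Sum>k<n. c k * (?w k * \<bar>D k f \<xi>\<bar> * ?g \<xi>)) = (\<Sum>k<n. ?w k * \<bar>D k f \<xi>\<bar> * c k) * ?g \<xi>"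
          unfolding sum_distrib_right by (intro sum.cong) (simp_all add: mult_ac)
        also have "\<dots> \<le> v * ?g \<xi>" using elim by (intro mult_right_mono) auto
        finally show ?case .
      qed
    qed
    finally show ?thesis by simp
  qed
  let ?m = "\<integral>\<eta>. f \<eta> \<partial>M"
  let ?e = "\<lambda>n. \<integral>\<xi>. \<bar>average_upto n f \<xi> - ?m\<bar> \<partial>M"
  \<comment> \<open>Replacing the average by the mean costs at most their L1 distance times the
    supremum bound for \<open>exp (s * f \<xi>)\<close>.\<close>
  have "(\<integral>\<xi>. (f \<xi> - ?m) * ?g \<xi> \<partial>M) \<le> s * v * (\<integral>\<xi>. ?g \<xi> \<partial>M) + ?e n * exp (s * C)" for n
  proof -
    let ?h = "average_upto n f"
    have int_h: "integrable M ?h" by (rule integrable_average_upto[OF int_f])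
    have "(\<integral>\<xi>. (f \<xi> - ?m) * ?g \<xi> \<partial>M) = (\<integral>\<xi>. (f \<xi> - ?h \<xi>) * ?g \<xi> + (?h \<xi> - ?m) * ?g \<xi> \<partial>M)"
      by (simp add: algebra_simps)
    also have "\<dots> = (\<integral>\<xi>. (f \<xi> - ?h \<xi>) * ?g \<xi> \<partial>M) + (\<integral>\<xi>. (?h \<xi> - ?m) * ?g \<xi> \<partial>M)"
      by (intro Bochner_Integration.integral_add int_prod Bochner_Integration.integrable_diff
        int_f int_h integrable_const)
    also have "(\<integral>\<xi>. (?h \<xi> - ?m) * ?g \<xi> \<partial>M) \<le> (\<integral>\<xi>. \<bar>?h \<xi> - ?m\<bar> * exp (s * C) \<partial>M)"
    proof (rule integral_mono)
      show "(?h \<xi> - ?m) * ?g \<xi> \<le> \<bar>?h \<xi> - ?m\<bar> * exp (s * C)" for \<xi>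
        using g_le[of \<xi>] by (intro mult_mono) auto
    qed (auto intro!: int_prod integrable_mult_left integrable_abs int_h
      Bochner_Integration.integrable_diff)
    finally show ?thesis using upto[of n] by simp
  qed
  moreover have "(\<lambda>n. s * v * (\<integral>\<xi>. ?g \<xi> \<partial>M) + ?e n * exp (s * C)) \<longlonglongrightarrow> s * v * (\<integral>\<xi>. ?g \<xi> \<partial>M)"
    by (auto intro!: tendsto_eq_intros average_upto_tendsto_L1 int_f)
  ultimately show ?thesis
    by (intro LIMSEQ_le_const) auto
qed

text \<open>The quantity bounded by the square of \<open>K\<close> in the final theorem, named so
  that it can be compared between a function, its negation and its truncations.\<close>

definition weighted_gradient_norm :: "((nat \<Rightarrow> int) \<Rightarrow> real) \<Rightarrow> ennreal" where
  "weighted_gradient_norm f = Linf_norm M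
     (\<lambda>\<xi>. \<Sum>k. ennreal (1 / (2 * min (p k) (1 - p k))) * ennreal \<bar>D k f \<xi>\<bar>
              * Linf_norm M (\<lambda>\<eta>. ennreal \<bar>D k f \<eta>\<bar>))"

lemma weighted_gradient_norm_mono:
  assumes [measurable]: "f \<in> borel_measurable M" and le: "\<And>k \<xi>. \<bar>D k f \<xi>\<bar> \<le> \<bar>D k g \<xi>\<bar>"
  shows "weighted_gradient_norm f \<le> weighted_gradient_norm g"
  unfolding weighted_gradient_norm_def Linf_norm_def
proof (rule esssup_mono)
  fix \<xi>
  show "(\<Sum>k. ennreal (1 / (2 * min (p k) (1 - p k))) * ennreal \<bar>D k f \<xi>\<bar>
              * esssup M (\<lambda>\<eta>. ennreal \<bar>D k f \<eta>\<bar>))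
      \<le> (\<Sum>k. ennreal (1 / (2 * min (p k) (1 - p k))) * ennreal \<bar>D k g \<xi>\<bar>
              * esssup M (\<lambda>\<eta>. ennreal \<bar>D k g \<eta>\<bar>))"
    using le by (intro suminf_le mult_mono order_refl esssup_mono ennreal_leI summableI) auto
qed measurable

lemma mgf_centered_le_nonneg:
  assumes f: "f \<in> borel_measurable M" "\<And>\<xi>. \<bar>f \<xi>\<bar> \<le> C"
    and v: "weighted_gradient_norm f \<le> ennreal v" "0 \<le> v" and "0 \<le> s"
  shows "(\<integral>\<xi>. exp (s * (f \<xi> - (\<integral>\<eta>. f \<eta> \<partial>M))) \<partial>M) \<le> exp (s\<^sup>2 * v / 2)"
proof -
  let ?m = "\<integral>\<eta>. f \<eta> \<partial>M"
  let ?w = "\<lambda>k. 1 / (2 * min (p k) (1 - p k))"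
  have int_f: "integrable M f"
    using f by (intro integrable_const_bound[where B = C]) auto
  define L where "L k = Linf_norm M (\<lambda>\<eta>. ennreal \<bar>D k f \<eta>\<bar>)" for k
  \<comment> \<open>A bounded function has bounded gradients, so each \<open>L k\<close> is finite
    and passing to the real number \<open>c k\<close> loses nothing.\<close>
  have L_le: "L k \<le> ennreal (sqrt (p k * (1 - p k)) * (C + C))" for k
    unfolding L_def Linf_norm_def
  proof (rule esssup_I)
    show "(\<lambda>\<eta>. ennreal \<bar>D k f \<eta>\<bar>) \<in> borel_measurable M" using f(1) by measurable
    have "\<bar>D k f \<xi>\<bar> \<le> sqrt (p k * (1 - p k)) * (C + C)" for \<xi>
    proof -
      have "\<bar>f (\<xi>(k := 1)) - f (\<xi>(k := -1))\<bar> \<le> C + C"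
        using f(2)[of "\<xi>(k := 1)"] f(2)[of "\<xi>(k := -1)"] by linarith
      then show ?thesis
        using p_pos[of k] p_less_1[of k]
        by (auto simp: discrete_gradient_def abs_mult intro!: mult_left_mono)
    qed
    then show "AE \<xi> in M. ennreal \<bar>D k f \<xi>\<bar> \<le> ennreal (sqrt (p k * (1 - p k)) * (C + C))"
      by (intro AE_I2 ennreal_leI)
  qed
  define c where "c k = enn2real (L k)" for k
  have L_eq: "L k = ennreal (c k)" for k
    unfolding c_def using order_le_less_trans[OF L_le[of k] ennreal_less_top] by simp
  have c0: "0 \<le> c k" for k by (simp add: c_def)
  have c: "AE \<xi> in M. \<bar>D k f \<xi>\<bar> \<le> c k" for k
  proof -
    have "AE \<xi> in M. ennreal \<bar>D k f \<xi>\<bar> \<le> L k"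
      unfolding L_def Linf_norm_def by (rule esssup_AE)
    then show ?thesis
      unfolding L_eq by eventually_elim (use c0[of k] in simp)
  qed
  have sum_le: "AE \<xi> in M. (\<Sum>k<n. ?w k * \<bar>D k f \<xi>\<bar> * c k) \<le> v" for n
  proof -
    let ?S = "\<lambda>\<xi>. \<Sum>k. ennreal (?w k) * ennreal \<bar>D k f \<xi>\<bar> * L k"
    have "AE \<xi> in M. ?S \<xi> \<le> weighted_gradient_norm f"
      unfolding weighted_gradient_norm_def L_def Linf_norm_def by (rule esssup_AE)
    then show ?thesis
    proof eventually_elim
      case (elim \<xi>)
      have w0: "0 \<le> ?w k" for k using p_pos[of k] p_less_1[of k] by simp
      have "ennreal (\<Sum>k<n. ?w k * \<bar>D k f \<xi>\<bar> * c k) = (\<Sum>k<n. ennreal (?w k * \<bar>D k f \<xi>\<bar> * c k))"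
        using c0 w0 by (intro sum_ennreal[symmetric] mult_nonneg_nonneg) auto
      also have "\<dots> = (\<Sum>k<n. ennreal (?w k) * ennreal \<bar>D k f \<xi>\<bar> * L k)"
        unfolding L_eq using c0 w0 by (intro sum.cong refl) (simp only: ennreal_mult mult_nonneg_nonneg abs_ge_zero)
      also have "\<dots> \<le> ?S \<xi>" by (intro sum_le_suminf summableI) auto
      also have "\<dots> \<le> ennreal v" using elim v(1) by (rule order_trans)
      finally show ?case using v(2) by simp
    qed
  qed
  have m_le: "\<bar>?m\<bar> \<le> C"
    using order_trans[OF integral_abs_bound, of M f C]
      integral_le_const[OF integrable_abs[OF int_f], of C] f(2) by auto
  have herbst: "(\<integral>\<xi>. (f \<xi> - ?m) * exp (t * (f \<xi> - ?m)) \<partial>M)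
      \<le> t * v * (\<integral>\<xi>. exp (t * (f \<xi> - ?m)) \<partial>M)" if "0 \<le> t" for t
  proof -
    \<comment> \<open>Centring multiplies both sides of the differential inequality by the same
      positive constant.\<close>
    have shift: "exp (t * (f \<xi> - ?m)) = exp (t * f \<xi>) * exp (- (t * ?m))" for \<xi>
      by (simp add: right_diff_distrib flip: exp_add)
    have "(\<integral>\<xi>. (f \<xi> - ?m) * exp (t * f \<xi>) \<partial>M) * exp (- (t * ?m))
        \<le> t * v * (\<integral>\<xi>. exp (t * f \<xi>) \<partial>M) * exp (- (t * ?m))"
      by (rule mult_right_mono[OF herbst_inequality[OF f c c0 sum_le that]]) simp
    then show ?thesis
      unfolding shift by (simp add: mult.assoc flip: integral_mult_left_zero)
  qed
  show ?thesis
  proof (rule mgf_le_gaussian[OF _ _ herbst \<open>0 \<le> s\<close>])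
    show "(\<lambda>\<xi>. f \<xi> - ?m) \<in> borel_measurable M" using f(1) by measurable
    show "\<bar>f \<xi> - ?m\<bar> \<le> C + C" for \<xi> using f(2)[of \<xi>] m_le by linarith
  qed
qed

text \<open>For negative \<open>s\<close> the bound is applied to the negated function, whose
  gradients have the same modulus. Both signs are needed to control the absolute deviation.\<close>

lemma mgf_centered_le:
  assumes f: "f \<in> borel_measurable M" "\<And>\<xi>. \<bar>f \<xi>\<bar> \<le> C"
    and v: "weighted_gradient_norm f \<le> ennreal v" "0 \<le> v"
  shows "(\<integral>\<xi>. exp (s * (f \<xi> - (\<integral>\<eta>. f \<eta> \<partial>M))) \<partial>M) \<le> exp (s\<^sup>2 * v / 2)"
proof (cases "0 \<le> s")
  case True
  then show ?thesis using mgf_centered_le_nonneg assms by blast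
next
  case False
  let ?g = "\<lambda>\<xi>. - f \<xi>"
  have "weighted_gradient_norm ?g \<le> weighted_gradient_norm f"
    using f(1) by (intro weighted_gradient_norm_mono)
      (auto simp: discrete_gradient_def abs_mult abs_minus_commute)
  then have "(\<integral>\<xi>. exp (- s * (?g \<xi> - (\<integral>\<eta>. ?g \<eta> \<partial>M))) \<partial>M) \<le> exp ((- s)\<^sup>2 * v / 2)"
    using False f v by (intro mgf_centered_le_nonneg[where C = C]) auto
  then show ?thesis by (simp add: algebra_simps)
qed

subsection \<open>Truncation\<close>

definition truncate :: "real \<Rightarrow> ((nat \<Rightarrow> int) \<Rightarrow> real) \<Rightarrow> (nat \<Rightarrow> int) \<Rightarrow> real" where
  "truncate R f \<xi> = max (- R) (min R (f \<xi>))"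

lemma measurable_truncate [measurable]:
  "f \<in> borel_measurable M \<Longrightarrow> truncate R f \<in> borel_measurable M"
  unfolding truncate_def[abs_def]
  by (intro borel_measurable_max borel_measurable_min borel_measurable_const)

lemma
  assumes "0 \<le> R"
  shows abs_truncate_le: "\<bar>truncate R f \<xi>\<bar> \<le> R"
    and abs_truncate_le_abs: "\<bar>truncate R f \<xi>\<bar> \<le> \<bar>f \<xi>\<bar>"
  using assms by (auto simp: truncate_def)

lemma truncate_eq: "\<bar>f \<xi>\<bar> \<le> R \<Longrightarrow> truncate R f \<xi> = f \<xi>"
  by (auto simp: truncate_def)

text \<open>Clamping is 1-Lipschitz, so every increment shrinks.\<close>

lemma weighted_gradient_norm_truncate_le:
  assumes "f \<in> borel_measurable M"
  shows "weighted_gradient_norm (truncate R f) \<le> weighted_gradient_norm f"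
proof (rule weighted_gradient_norm_mono)
  show "\<bar>D k (truncate R f) \<xi>\<bar> \<le> \<bar>D k f \<xi>\<bar>" for k \<xi>
    unfolding discrete_gradient_def abs_mult
    by (intro mult_left_mono) (auto simp: truncate_def max_def min_def)
qed (use assms in measurable)

lemma tendsto_truncate: "(\<lambda>n. truncate (real n) f \<xi>) \<longlonglongrightarrow> f \<xi>"
proof (rule tendsto_eventually)
  obtain N where "\<bar>f \<xi>\<bar> \<le> real N" using real_arch_simple by blast
  then have "truncate (real n) f \<xi> = f \<xi>" if "n \<ge> N" for n
    using that by (intro truncate_eq) linarith
  then show "\<forall>\<^sub>F n in sequentially. truncate (real n) f \<xi> = f \<xi>"
    by (auto simp: eventually_sequentially)
qed

section \<open>Removing boundedness: integrability and the Chernoff bound\<close>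

context
  fixes f :: "(nat \<Rightarrow> int) \<Rightarrow> real" and v :: real
  assumes f [measurable]: "f \<in> borel_measurable M"
    and norm_le: "weighted_gradient_norm f \<le> ennreal v" and v_nonneg: "0 \<le> v"
begin

abbreviation "T n \<equiv> truncate (real n) f"
abbreviation "m n \<equiv> \<integral>\<xi>. T n \<xi> \<partial>M"

lemma integrable_T: "integrable M (T n)"
  using abs_truncate_le[of "real n" f] by (intro integrable_const_bound[where B = "real n"]) auto

lemma integrable_exp_T: "integrable M (\<lambda>\<xi>. exp (s * (T n \<xi> - m n)))"
proof (rule integrable_const_bound[where B = "exp (\<bar>s\<bar> * (real n + \<bar>m n\<bar>))"])
  have "s * (T n \<xi> - m n) \<le> \<bar>s\<bar> * (real n + \<bar>m n\<bar>)" for \<xi>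
  proof -
    have "s * (T n \<xi> - m n) \<le> \<bar>s\<bar> * \<bar>T n \<xi> - m n\<bar>" by (simp flip: abs_mult)
    also have "\<dots> \<le> \<bar>s\<bar> * (real n + \<bar>m n\<bar>)"
      using abs_truncate_le[of "real n" f \<xi>] by (intro mult_left_mono) linarith+
    finally show ?thesis .
  qed
  then show "AE \<xi> in M. norm (exp (s * (T n \<xi> - m n))) \<le> exp (\<bar>s\<bar> * (real n + \<bar>m n\<bar>))"
    by simp
qed measurable

lemma mgf_T_le: "(\<integral>\<xi>. exp (s * (T n \<xi> - m n)) \<partial>M) \<le> exp (s\<^sup>2 * v / 2)"
proof (rule mgf_centered_le)
  show "weighted_gradient_norm (T n) \<le> ennreal v"
    using weighted_gradient_norm_truncate_le[OF f] norm_le by (rule order_trans)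
  show "\<bar>T n \<xi>\<bar> \<le> real n" for \<xi> by (rule abs_truncate_le) simp
qed (use v_nonneg in measurable)

text \<open>The inequality \<open>\<bar>z\<bar> \<le> exp z + exp (- z)\<close> reduces this to the
  Laplace transform at 1 and -1. The bound does not depend on \<open>n\<close>.\<close>

lemma L1_deviation_T_le: "(\<integral>\<xi>. \<bar>T n \<xi> - m n\<bar> \<partial>M) \<le> 2 * exp (v / 2)"
proof -
  have "(\<integral>\<xi>. \<bar>T n \<xi> - m n\<bar> \<partial>M)
      \<le> (\<integral>\<xi>. exp (1 * (T n \<xi> - m n)) + exp ((-1) * (T n \<xi> - m n)) \<partial>M)"
  proof (rule integral_mono)
    show "\<bar>T n \<xi> - m n\<bar> \<le> exp (1 * (T n \<xi> - m n)) + exp ((-1) * (T n \<xi> - m n))" for \<xi>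
    proof -
      have "\<bar>z\<bar> \<le> exp z + exp (- z)" for z :: real
        using exp_ge_add_one_self[of z] exp_ge_add_one_self[of "- z"]
          exp_gt_zero[of z] exp_gt_zero[of "- z"] by linarith
      from this[of "T n \<xi> - m n"] show ?thesis by simp
    qed
  qed (intro integrable_abs Bochner_Integration.integrable_diff Bochner_Integration.integrable_add
    integrable_T integrable_const integrable_exp_T)+
  also have "\<dots> = (\<integral>\<xi>. exp (1 * (T n \<xi> - m n)) \<partial>M) + (\<integral>\<xi>. exp ((-1) * (T n \<xi> - m n)) \<partial>M)"
    by (intro Bochner_Integration.integral_add integrable_exp_T)
  also have "\<dots> \<le> exp (1\<^sup>2 * v / 2) + exp ((-1)\<^sup>2 * v / 2)"
    by (intro add_mono mgf_T_le)
  finally show ?thesis by simp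
qed

text \<open>The deviations from the means are under control, so it remains to bound the means. Since
  \<open>f\<close> is finite, some event \<open>\<bar>f\<bar> \<le> N\<close> has probability above
  one half, and there every truncation is at most \<open>N\<close> in modulus.\<close>

lemma integral_abs_T_bounded: "\<exists>B. \<forall>n. (\<integral>\<xi>. \<bar>T n \<xi>\<bar> \<partial>M) \<le> B"
proof -
  let ?A = "\<lambda>n. {\<xi> \<in> space M. \<bar>f \<xi>\<bar> \<le> real n}"
  have "(\<lambda>n. prob (?A n)) \<longlonglongrightarrow> prob (\<Union>n. ?A n)"
    by (intro finite_Lim_measure_incseq) (auto simp: incseq_def)
  moreover have "(\<Union>n. ?A n) = space M" using real_arch_simple by auto
  ultimately have "(\<lambda>n. prob (?A n)) \<longlonglongrightarrow> 1" by (simp add: prob_space)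
  then have "\<forall>\<^sub>F n in sequentially. 1 / 2 < prob (?A n)" by (rule order_tendstoD) simp
  then obtain N where N: "1 / 2 < prob (?A N)" by (auto simp: eventually_sequentially)
  let ?L = "2 * exp (v / 2)"
  \<comment> \<open>The outer factor 2 comes from dividing by the probability of that event.\<close>
  have m_le: "\<bar>m n\<bar> \<le> 2 * (?L + real N)" for n
  proof -
    have "\<bar>m n\<bar> * prob (?A N) = (\<integral>\<xi>. \<bar>m n\<bar> * indicator (?A N) \<xi> \<partial>M)"
      by simp
    also have "\<dots> \<le> (\<integral>\<xi>. \<bar>T n \<xi> - m n\<bar> + real N \<partial>M)"
    proof (rule integral_mono)
      show "integrable M (\<lambda>\<xi>. \<bar>m n\<bar> * indicator (?A N) \<xi>)"
        by (intro integrable_mult_right integrable_real_indicator) (auto simp: less_top[symmetric])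
      show "integrable M (\<lambda>\<xi>. \<bar>T n \<xi> - m n\<bar> + real N)"
        by (intro integrable_abs Bochner_Integration.integrable_diff
          Bochner_Integration.integrable_add integrable_T integrable_const)
      show "\<bar>m n\<bar> * indicator (?A N) \<xi> \<le> \<bar>T n \<xi> - m n\<bar> + real N" for \<xi>
        using abs_truncate_le_abs[of "real n" f \<xi>] by (auto simp: indicator_def)
    qed
    also have "\<dots> = (\<integral>\<xi>. \<bar>T n \<xi> - m n\<bar> \<partial>M) + real N"
      using integrable_T[of n] by (simp add: prob_space)
    also have "\<dots> \<le> ?L + real N" using L1_deviation_T_le[of n] by simp
    finally have *: "\<bar>m n\<bar> * prob (?A N) \<le> ?L + real N" .
    have "\<bar>m n\<bar> * (1 / 2) \<le> \<bar>m n\<bar> * prob (?A N)"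
      using N by (intro mult_left_mono) auto
    from order_trans[OF this *] show ?thesis by simp
  qed
  have "(\<integral>\<xi>. \<bar>T n \<xi>\<bar> \<partial>M) \<le> ?L + 2 * (?L + real N)" for n
  proof -
    have "(\<integral>\<xi>. \<bar>T n \<xi>\<bar> \<partial>M) \<le> (\<integral>\<xi>. \<bar>T n \<xi> - m n\<bar> + \<bar>m n\<bar> \<partial>M)"
    proof (rule integral_mono)
      show "integrable M (\<lambda>\<xi>. \<bar>T n \<xi> - m n\<bar> + \<bar>m n\<bar>)"
        by (intro integrable_abs Bochner_Integration.integrable_diff
          Bochner_Integration.integrable_add integrable_T integrable_const)
    qed (use integrable_T[of n] in auto)
    also have "\<dots> = (\<integral>\<xi>. \<bar>T n \<xi> - m n\<bar> \<partial>M) + \<bar>m n\<bar>"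
      using integrable_T[of n] by (simp add: prob_space)
    finally show ?thesis using L1_deviation_T_le[of n] m_le[of n] by linarith
  qed
  then show ?thesis by blast
qed

text \<open>Fatou's lemma along the truncations. This makes the mean in the tail bound a genuine
  expectation rather than the default value 0 of the Bochner integral.\<close>

lemma integrable_of_norm_le: "integrable M f"
proof -
  obtain B where B: "\<And>n. (\<integral>\<xi>. \<bar>T n \<xi>\<bar> \<partial>M) \<le> B" using integral_abs_T_bounded by blast
  have "(\<integral>\<^sup>+\<xi>. ennreal \<bar>f \<xi>\<bar> \<partial>M) = (\<integral>\<^sup>+\<xi>. liminf (\<lambda>n. ennreal \<bar>T n \<xi>\<bar>) \<partial>M)"
  proof (intro nn_integral_cong)
    fix \<xi>
    have "(\<lambda>n. ennreal \<bar>T n \<xi>\<bar>) \<longlonglongrightarrow> ennreal \<bar>f \<xi>\<bar>"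
      by (intro tendsto_ennrealI tendsto_rabs tendsto_truncate)
    then show "ennreal \<bar>f \<xi>\<bar> = liminf (\<lambda>n. ennreal \<bar>T n \<xi>\<bar>)"
      by (intro lim_imp_Liminf[symmetric]) auto
  qed
  also have "\<dots> \<le> liminf (\<lambda>n. \<integral>\<^sup>+\<xi>. ennreal \<bar>T n \<xi>\<bar> \<partial>M)"
    by (rule nn_integral_liminf) measurable
  also have "\<dots> \<le> liminf (\<lambda>n. ennreal B)"
  proof (intro Liminf_mono always_eventually allI)
    fix n
    have "(\<integral>\<^sup>+\<xi>. ennreal \<bar>T n \<xi>\<bar> \<partial>M) = ennreal (\<integral>\<xi>. \<bar>T n \<xi>\<bar> \<partial>M)"
      by (intro nn_integral_eq_integral integrable_abs integrable_T) auto
    also have "\<dots> \<le> ennreal B" by (intro ennreal_leI B)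
    finally show "(\<integral>\<^sup>+\<xi>. ennreal \<bar>T n \<xi>\<bar> \<partial>M) \<le> ennreal B" .
  qed
  also have "\<dots> = ennreal B" by (simp add: Liminf_const)
  finally have "(\<integral>\<^sup>+\<xi>. ennreal \<bar>f \<xi>\<bar> \<partial>M) \<le> ennreal B" .
  then show ?thesis
    unfolding integrable_iff_bounded using f by (simp add: order_le_less_trans[OF _ ennreal_less_top])
qed

lemma mean_T_tendsto: "m \<longlonglongrightarrow> (\<integral>\<xi>. f \<xi> \<partial>M)"
proof (rule integral_dominated_convergence[where w = "\<lambda>\<xi>. \<bar>f \<xi>\<bar>"])
  show "integrable M (\<lambda>\<xi>. \<bar>f \<xi>\<bar>)" by (intro integrable_abs integrable_of_norm_le)
  show "AE \<xi> in M. (\<lambda>n. T n \<xi>) \<longlonglongrightarrow> f \<xi>"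
    by (rule AE_I2) (rule tendsto_truncate)
  show "AE \<xi> in M. norm (T n \<xi>) \<le> \<bar>f \<xi>\<bar>" for n
    using abs_truncate_le_abs[of "real n" f] by (intro AE_I2) simp
  show "T n \<in> borel_measurable M" for n by (rule measurable_truncate[OF f])
qed (rule f)

text \<open>Markov's inequality is applied to the exponential of a centred truncation; convergence
  of the truncated means then gives the bound for \<open>f\<close>.\<close>

lemma chernoff_bound:
  assumes "0 \<le> s"
  shows "prob {\<xi> \<in> space M. f \<xi> - (\<integral>\<eta>. f \<eta> \<partial>M) \<ge> x} \<le> exp (s\<^sup>2 * v / 2 - s * x)"
proof -
  let ?\<mu> = "\<integral>\<eta>. f \<eta> \<partial>M" and ?P = "prob {\<xi> \<in> space M. f \<xi> - (\<integral>\<eta>. f \<eta> \<partial>M) \<ge> x}"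
  \<comment> \<open>For such \<open>n\<close> the clamping level is not below the threshold
    \<open>x + ?\<mu>\<close>, so wherever \<open>f\<close> reaches the threshold its truncation
    does too.\<close>
  have le: "?P \<le> exp (s\<^sup>2 * v / 2 - s * (x + ?\<mu> - m n))" if n: "x + ?\<mu> \<le> real n" for n
  proof -
    let ?c = "exp (s * (x + ?\<mu> - m n))"
    have "?P \<le> prob {\<xi> \<in> space M. exp (s * (T n \<xi> - m n)) \<ge> ?c}"
    proof (rule finite_measure_mono)
      show "{\<xi> \<in> space M. f \<xi> - ?\<mu> \<ge> x} \<subseteq> {\<xi> \<in> space M. exp (s * (T n \<xi> - m n)) \<ge> ?c}"
        using n \<open>0 \<le> s\<close> by (auto simp: truncate_def intro!: mult_left_mono)
    qed measurable
    also have "\<dots> \<le> (\<integral>\<xi>. exp (s * (T n \<xi> - m n)) \<partial>M) / ?c"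
      by (rule integral_Markov_inequality_measure[OF integrable_exp_T sets.empty_sets]) auto
    also have "\<dots> \<le> exp (s\<^sup>2 * v / 2) / ?c"
      by (intro divide_right_mono mgf_T_le) simp
    finally show ?thesis by (simp add: exp_diff)
  qed
  have "(\<lambda>n. exp (s\<^sup>2 * v / 2 - s * (x + ?\<mu> - m n))) \<longlonglongrightarrow> exp (s\<^sup>2 * v / 2 - s * (x + ?\<mu> - ?\<mu>))"
    by (intro tendsto_intros mean_T_tendsto)
  then have "?P \<le> exp (s\<^sup>2 * v / 2 - s * (x + ?\<mu> - ?\<mu>))"
  proof (rule LIMSEQ_le_const)
    obtain N where "x + ?\<mu> \<le> real N" using real_arch_simple by blast
    then have "x + ?\<mu> \<le> real n" if "n \<ge> N" for n
      using that by linarith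
    then show "\<exists>N. \<forall>n\<ge>N. ?P \<le> exp (s\<^sup>2 * v / 2 - s * (x + ?\<mu> - m n))"
      using le by blast
  qed
  then show ?thesis by simp
qed

end

end

theorem proposition12p3:
  fixes p :: "nat \<Rightarrow> real" and K :: real and F :: "(nat \<Rightarrow> int) \<Rightarrow> real"
  assumes "\<And>k. 0 < p k \<and> p k < 1"
    and "K > 0"
    and "F \<in> borel_measurable (bernoulli_space p)"
    and "Linf_norm (bernoulli_space p)
           (\<lambda>\<omega>. \<Sum>k. ennreal (1 / (2 * min (p k) (1 - p k)))
                     * ennreal \<bar>discrete_gradient p k F \<omega>\<bar>
                     * Linf_norm (bernoulli_space p) (\<lambda>\<eta>. ennreal \<bar>discrete_gradient p k F \<eta>\<bar>))
         \<le> ennreal (K\<^sup>2)"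
  shows "\<forall>x\<ge>0. measure (bernoulli_space p)
                  {\<omega> \<in> space (bernoulli_space p).
                     F \<omega> - integral\<^sup>L (bernoulli_space p) F \<ge> x}
                \<le> exp (- (x\<^sup>2 / (2 * K\<^sup>2)))"
proof (intro allI impI)
  interpret biased_signs p using assms(1) by unfold_locales auto
  fix x :: real assume "0 \<le> x"
  \<comment> \<open>The Chernoff exponent is minimized by taking
    \<open>s = x / K\<^sup>2\<close>.\<close>
  have "prob {\<xi> \<in> space M. F \<xi> - (\<integral>\<eta>. F \<eta> \<partial>M) \<ge> x}
      \<le> exp ((x / K\<^sup>2)\<^sup>2 * K\<^sup>2 / 2 - x / K\<^sup>2 * x)"
    using assms(3,4) \<open>0 \<le> x\<close> by (intro chernoff_bound) (auto simp: weighted_gradient_norm_def)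
  also have "(x / K\<^sup>2)\<^sup>2 * K\<^sup>2 / 2 - x / K\<^sup>2 * x = - (x\<^sup>2 / (2 * K\<^sup>2))"
    using \<open>K > 0\<close> by (simp add: power2_eq_square field_simps)
  finally show "prob {\<xi> \<in> space M. F \<xi> - (\<integral>\<eta>. F \<eta> \<partial>M) \<ge> x} \<le> exp (- (x\<^sup>2 / (2 * K\<^sup>2)))" .
qed

end
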